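(* Let $d \ge 2$ and $0 \le k < d$ be integers. The following are equivalent: (i) $k = d-1$; (ii) there exists a compact set $K \subseteq [0,1]^d$ such that $K$ intersects each $k$-dimensional affine subspace of $\mathbb{R}^d$ that meets $[0,1]^d$, but the $d$-fold sumset $dK$ is nowhere dense in $\mathbb{R}^d$; (iii) there exists a compact set $K \subseteq [0,1]^d$ such that $K$ intersects each $k$-dimensional affine subspace of $\mathbb{R}^d$ that meets $[0,1]^d$, but the $(d-1)$-fold sumset $(d-1)K$ is nowhere dense in $\mathbb{R}^d$.
   Context: For a positive integer $\ell$ and $K \subseteq \mathbb{R}^d$, the $\ell$-fold sumset is $\ell K = \{x_1+\dots+x_\ell : x_1,\dots,x_\ell\in K\}$ (not the dilate of $K$ by $\ell$); in particular $1K=K$. *)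

theory Defs
  imports "HOL-Analysis.Analysis"
begin

definition nowhere_dense :: "'a::topological_space set \<Rightarrow> bool" where
  "nowhere_dense S \<longleftrightarrow> interior (closure S) = {}"

definition fold_sumset :: "nat \<Rightarrow> 'a::comm_monoid_add set \<Rightarrow> 'a set" where
  "fold_sumset l K = {\<Sum>i<l. x i | x. \<forall>i<l. x i \<in> K}"

definition unit_cube :: "(real ^ 'n) set" where
  "unit_cube = {x. \<forall>i. 0 \<le> x $ i \<and> x $ i \<le> 1}"

(* aff_dim S = int k forces S to be nonempty, since aff_dim {} = -1 *)
definition meets_all_flats :: "nat \<Rightarrow> (real ^ 'n) set \<Rightarrow> bool" where
  "meets_all_flats k K \<longleftrightarrow>
     (\<forall>S. affine S \<and> aff_dim S = int k \<and> S \<inter> unit_cube \<noteq> {} \<longrightarrow> K \<inter> S \<noteq> {})"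

end

theory Submission
  imports Defs
begin

text \<open>
  If \<open>k \<le> d - 2\<close>, then \<open>K\<close> contains every edge of the cube at the origin, because some \<open>k\<close>-flat meets the
  cube exactly in a given point of that edge. Moreover \<open>K\<close> meets each codimension 2 flat obtained by
  fixing two coordinates in \<open>[0,1]\<close>. Adding the edges in the other \<open>d - 2\<close> directions to \<open>K\<close> therefore
  gives a set with interior, by the Baire argument for a finite closed cover.

  If \<open>k = d - 1\<close>, take the self-similar set \<open>K\<close> obtained by iterating \<open>M \<mapsto> \<Union>a\<in>D. (a + M) / m\<close> from the
  cube. If the first iterate \<open>M\<close> meets every hyperplane that meets the cube, then so does each iterate, by
  rescaling, and hence \<open>K\<close>. If in addition the \<open>d\<close>-fold sums of \<open>M\<close> miss a point \<open>w\<close> modulo \<open>\<int>\<^sup>d\<close>, then those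
  of \<open>K\<close> miss \<open>(w + \<int>\<^sup>d) / m\<^sup>n\<close> for every \<open>n\<close>, which is a dense set. Such an \<open>M\<close> is a fine grid
  approximation of a compact set made of the cube edges in all but two directions together with copies of a
  planar set, whose components cannot be separated by a line although they are disjoint.
\<close>

section \<open>Sumsets and flats of codimension at least 2\<close>

lemma fold_sumset_0 [simp]: "fold_sumset 0 K = {0}"
  by (simp add: fold_sumset_def)

lemma fold_sumset_Suc:
  "fold_sumset (Suc l) K = {x + y | x y. x \<in> fold_sumset l K \<and> y \<in> K}" (is "_ = ?R")
proof
  show "fold_sumset (Suc l) K \<subseteq> ?R"
    by (force simp: fold_sumset_def)
  show "?R \<subseteq> fold_sumset (Suc l) K"
  proof clarify
    fix x y assume "x \<in> fold_sumset l K" and y: "y \<in> K"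
    then obtain f where f: "x = (\<Sum>i<l. f i)" "\<forall>i<l. f i \<in> K"
      by (auto simp: fold_sumset_def)
    have "x + y = (\<Sum>i<Suc l. (f(l := y)) i)"
      using f by simp
    moreover have "\<forall>i<Suc l. (f(l := y)) i \<in> K"
      using f y by (auto simp: less_Suc_eq)
    ultimately show "x + y \<in> fold_sumset (Suc l) K"
      unfolding fold_sumset_def by blast
  qed
qed

lemma compact_fold_sumset:
  fixes K :: "'a::real_normed_vector set"
  assumes "compact K"
  shows "compact (fold_sumset l K)"
  by (induction l) (use assms in \<open>simp_all add: fold_sumset_Suc compact_sums\<close>)

lemma fold_sumset_subset_Suc:
  assumes "0 \<in> K"
  shows "fold_sumset l K \<subseteq> fold_sumset (Suc l) K"
  using assms by (force simp: fold_sumset_Suc)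

text \<open>Meant for \<open>y\<close> in \<open>K\<close> and one point \<open>f j\<close> on the
  edge in each direction \<open>j\<close> of \<open>J\<close>.\<close>

lemma add_sum_in_fold_sumset:
  assumes "finite J" "y \<in> K" "\<And>j. j \<in> J \<Longrightarrow> f j \<in> K"
  shows "y + sum f J \<in> fold_sumset (Suc (card J)) K"
  using assms
proof (induction J)
  case empty
  then show ?case by (force simp: fold_sumset_Suc)
next
  case (insert j J)
  then have "y + sum f J \<in> fold_sumset (Suc (card J)) K" "f j \<in> K"
    by auto
  then have "(y + sum f J) + f j \<in> fold_sumset (Suc (Suc (card J))) K"
    by (subst fold_sumset_Suc) blast
  with insert show ?case by (simp add: ac_simps)
qed

lemma compact_unit_cube: "compact (unit_cube :: (real^'n) set)"
proof -
  have "(unit_cube :: (real^'n) set) = cbox 0 1"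
    by (auto simp: unit_cube_def mem_box_cart)
  then show ?thesis by (metis compact_cbox)
qed

lemma interior_Union_closed_empty:
  assumes "finite F" "\<And>S. S \<in> F \<Longrightarrow> closed S \<and> interior S = {}"
  shows "interior (\<Union>F) = {}"
  using assms
  by (induction F) (auto simp: interior_closed_Un_empty_interior)

section \<open>Flats of codimension at least 2 force interior\<close>

text \<open>The orthogonal complement of \<open>u\<close> and \<open>v\<close> has dimension at
  least \<open>d - 2\<close>, hence contains a subspace \<open>T\<close> of dimension
  \<open>k\<close>. On the flat \<open>p + T\<close> both equations hold, and this flat meets the
  cube at \<open>p\<close>.\<close>

lemma meets_all_flats_two_equations:
  fixes K :: "(real^'n) set"
  assumes "meets_all_flats k K" "k + 2 \<le> CARD('n)" "p \<in> unit_cube"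
  shows "\<exists>x\<in>K. u \<bullet> x = u \<bullet> p \<and> v \<bullet> x = v \<bullet> p"
proof -
  define W where "W = {y::real^'n. \<forall>x\<in>span {u,v}. orthogonal x y}"
  have "dim {y \<in> (UNIV::(real^'n) set). \<forall>x\<in>span {u,v}. orthogonal x y} + dim (span {u,v}) = dim (UNIV::(real^'n) set)"
    by (rule dim_subspace_orthogonal_to_vectors) auto
  then have "dim W + dim {u,v} = CARD('n)"
    by (simp add: W_def)
  moreover have "dim {u,v} \<le> card {u,v}"
    by (rule dim_le_card') simp
  moreover have "card {u,v} \<le> 2"
    by (simp add: card_insert_if)
  ultimately have "k \<le> dim W"
    using assms by linarith
  then obtain T where T: "subspace T" "T \<subseteq> span W" "dim T = k"
    using choose_subspace_of_subspace by metis
  have "subspace W"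
    unfolding W_def by (auto simp: subspace_def orthogonal_def inner_add_right)
  with T have TW: "T \<subseteq> W"
    by (metis span_eq_iff)
  define S where "S = (+) p ` T"
  have "affine S" "aff_dim S = int k"
    using T by (simp_all add: S_def affine_translation[symmetric] subspace_imp_affine
        aff_dim_translation_eq aff_dim_subspace)
  moreover have "p \<in> S"
    unfolding S_def using T(1) by (force simp: subspace_0)
  ultimately obtain x where x: "x \<in> K" "x \<in> S"
    using assms unfolding meets_all_flats_def by blast
  then obtain t where "x = p + t" "t \<in> W"
    using TW by (auto simp: S_def)
  moreover from this have "u \<bullet> t = 0" "v \<bullet> t = 0"
    by (auto simp: W_def orthogonal_def span_base)
  ultimately have "u \<bullet> x = u \<bullet> p \<and> v \<bullet> x = v \<bullet> p"
    by (simp add: inner_add_right)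
  with x(1) show ?thesis by blast
qed

text \<open>Fix coordinate \<open>j\<close> and the coordinate sum, both to the value
  \<open>t\<close>. The other coordinates then sum to 0, and being nonnegative they vanish, so the
  only solution in the cube is the given point of the edge.\<close>

lemma axis_segment_in_if_meets_all_flats:
  fixes K :: "(real^'n) set"
  assumes "meets_all_flats k K" "k + 2 \<le> CARD('n)" "K \<subseteq> unit_cube" "0 \<le> t" "t \<le> 1"
  shows "t *\<^sub>R axis j 1 \<in> K"
proof -
  define p :: "real^'n" where "p = t *\<^sub>R axis j 1"
  have "p \<in> unit_cube"
    using assms by (auto simp: p_def unit_cube_def axis_def)
  then obtain x where x: "x \<in> K" "axis j 1 \<bullet> x = axis j 1 \<bullet> p" "1 \<bullet> x = 1 \<bullet> p"
    using meets_all_flats_two_equations[OF assms(1,2)] by blast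
  have xj: "x $ j = p $ j"
    using x(2) by (simp add: inner_axis')
  have "(\<Sum>i\<in>UNIV. x $ i) = (\<Sum>i\<in>UNIV. p $ i)"
    using x(3) by (simp add: inner_vec_def)
  then have "(\<Sum>i\<in>UNIV - {j}. x $ i) = (\<Sum>i\<in>UNIV - {j}. p $ i)"
    using xj by (simp add: sum.remove[of UNIV j])
  also have "\<dots> = 0"
    by (rule sum.neutral) (auto simp: p_def axis_def)
  finally have "\<forall>i\<in>UNIV - {j}. x $ i = 0"
    using x(1) assms(3) by (subst (asm) sum_nonneg_eq_0_iff) (auto simp: unit_cube_def)
  then have "x = p"
    using xj by (auto simp: vec_eq_iff p_def axis_def)
  with x(1) show ?thesis by (simp add: p_def)
qed

text \<open>Fixing the coordinates \<open>i0\<close> and \<open>i1\<close> shows that the sets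
  \<open>KC C + V\<close> cover the open cube, so one of these finitely many closed sets has
  interior. Replacing the subspace \<open>V\<close> by sums of unit edges keeps an open ball,
  because the points of \<open>KC C\<close> vary by at most \<open>1/2\<close> in each
  coordinate.\<close>

lemma interior_fold_sumset_if_meets_all_flats:
  fixes K :: "(real^'n) set"
  assumes K: "compact K" "K \<subseteq> unit_cube" "meets_all_flats k K" and k: "k + 2 \<le> CARD('n)"
  shows "interior (fold_sumset (CARD('n) - 1) K) \<noteq> {}"
proof -
  obtain i0 i1 :: 'n where i01: "i0 \<noteq> i1"
    using k by (metis card_le_Suc0_iff_eq finite UNIV_I add_leD2 not_less_eq_eq numeral_2_eq_2)
  define J where "J = UNIV - {i0, i1}"
  have cardJ: "Suc (card J) = CARD('n) - 1"
    using k i01 by (simp add: J_def card_Diff_subset)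
  \<comment> \<open>\<open>KC C\<close> is the part of \<open>K\<close> in the dyadic subcube indexed by \<open>C\<close>: adding the unit segments
      in the directions \<open>J\<close> to any of its points always covers the same interval of length \<open>1/2\<close>.\<close>
  define KC where "KC C = {x \<in> K. \<forall>j. if j \<in> C then 1/2 \<le> x $ j else x $ j \<le> 1/2}" for C
  define V where "V = {v :: real^'n. v $ i0 = 0 \<and> v $ i1 = 0}"
  define G where "G C = (\<Union>x\<in>KC C. \<Union>y\<in>V. {x + y})" for C
  have "closed {x :: real^'n. \<forall>j. if j \<in> C then 1/2 \<le> x $ j else x $ j \<le> 1/2}" for C
  proof (rule closed_Collect_all)
    show "closed {x :: real^'n. if j \<in> C then 1/2 \<le> x $ j else x $ j \<le> 1/2}" for j
      by (cases "j \<in> C") (auto intro!: closed_Collect_le continuous_intros)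
  qed
  then have "compact (KC C)" for C
    using compact_Int_closed[OF K(1), of "{x. \<forall>j. if j \<in> C then 1/2 \<le> x $ j else x $ j \<le> 1/2}"]
    by (simp add: KC_def Int_def)
  moreover have "closed V"
    unfolding V_def by (intro closed_Collect_conj closed_Collect_eq continuous_intros)
  ultimately have closed_G: "closed (G C)" for C
    unfolding G_def by (rule compact_closed_sums)
  have "box 0 1 \<subseteq> \<Union>(range G)"
  proof
    fix z :: "real^'n" assume z: "z \<in> box 0 1"
    then have "z \<in> unit_cube"
      by (auto simp: mem_box_cart unit_cube_def less_imp_le)
    then obtain x where x: "x \<in> K" "axis i0 1 \<bullet> x = axis i0 1 \<bullet> z" "axis i1 1 \<bullet> x = axis i1 1 \<bullet> z"
      using meets_all_flats_two_equations[OF K(3) k] by blast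
    then have "z - x \<in> V"
      by (simp add: V_def inner_axis')
    moreover have "x \<in> KC {j. 1/2 \<le> x $ j}"
      using x by (auto simp: KC_def)
    ultimately show "z \<in> \<Union>(range G)"
      unfolding G_def by force
  qed
  then have "box 0 (1::real^'n) \<subseteq> interior (\<Union>(range G))"
    by (simp add: interior_maximal open_box)
  moreover have "(\<chi> i. 1/2) \<in> box 0 (1::real^'n)"
    by (simp add: mem_box_cart)
  ultimately have "interior (\<Union>(range G)) \<noteq> {}"
    by blast
  then obtain C z0 where "z0 \<in> interior (G C)"
    using interior_Union_closed_empty[of "range G"] closed_G by auto
  then obtain e0 where e0: "0 < e0" "ball z0 e0 \<subseteq> G C"
    by (auto simp: mem_interior)
  define e where "e = min e0 (1/4)"
  define c where "c j = (if j \<in> C then 1/2 else 0 :: real)" for j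
  \<comment> \<open>For \<open>x $ j\<close> between \<open>c j\<close> and
    \<open>c j + 1/2\<close>, the interval from \<open>x $ j\<close> to \<open>x $ j + 1\<close>
    contains \<open>[c j + 1/2, c j + 1]\<close>. Its midpoint is \<open>c j + 3/4\<close>, and
    \<open>e\<close> is at most its half-length.\<close>
  define z where "z = (\<chi> j. if j \<in> J then c j + 3/4 else z0 $ j)"
  have e: "0 < e" "e \<le> 1/4" "e \<le> e0" using e0 by (auto simp: e_def)
  have "ball z e \<subseteq> fold_sumset (Suc (card J)) K"
  proof
    fix y assume y: "y \<in> ball z e"
    have "dist z0 (y - z + z0) < e0"
      using y e by (simp add: dist_norm norm_minus_commute)
    then have "y - z + z0 \<in> G C" using e0 by auto
    then obtain x v where x: "x \<in> KC C" "v \<in> V" "y - z + z0 = x + v"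
      by (auto simp: G_def)
    \<comment> \<open>Off \<open>J\<close> the vectors \<open>z\<close> and \<open>z0\<close> agree
      and \<open>v\<close> vanishes. Thus \<open>x\<close> differs from \<open>y\<close> only in
      directions of \<open>J\<close>, where the edges make up the difference.\<close>
    have "x $ i = y $ i" if "i \<notin> J" for i
    proof -
      have "(y - z + z0) $ i = (x + v) $ i" using x by simp
      with that x(2) show ?thesis by (auto simp: J_def V_def z_def)
    qed
    then have y_eq: "y = x + (\<Sum>j\<in>J. (y $ j - x $ j) *\<^sub>R axis j 1)"
      by (auto simp: vec_eq_iff axis_def if_distrib sum.If_cases cong: if_cong)
    have "(y $ j - x $ j) *\<^sub>R axis j 1 \<in> K" if j: "j \<in> J" for j
    proof -
      have "\<bar>(y - z) $ j\<bar> < e"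
        using y component_le_norm_cart[of "y - z" j] by (simp add: dist_norm norm_minus_commute)
      then have "c j + 1/2 \<le> y $ j" "y $ j \<le> c j + 1"
        using e j by (auto simp: z_def)
      moreover have "x \<in> K" and xj: "if j \<in> C then 1/2 \<le> x $ j else x $ j \<le> 1/2"
        using x(1) unfolding KC_def by blast+
      then have "0 \<le> x $ j" "x $ j \<le> 1"
        using K(2) by (auto simp: unit_cube_def)
      with xj have "c j \<le> x $ j" "x $ j \<le> c j + 1/2"
        by (auto simp: c_def split: if_splits)
      ultimately show ?thesis
        using axis_segment_in_if_meets_all_flats[OF K(3) k K(2)] by auto
    qed
    moreover have "x \<in> K" using x by (simp add: KC_def)
    ultimately show "y \<in> fold_sumset (Suc (card J)) K"
      by (subst y_eq, intro add_sum_in_fold_sumset) auto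
  qed
  then have "z \<in> interior (fold_sumset (CARD('n) - 1) K)"
    unfolding cardJ[symmetric] mem_interior using e(1) by blast
  then show ?thesis by blast
qed

lemma nowhere_dense_subset:
  "S \<subseteq> T \<Longrightarrow> nowhere_dense T \<Longrightarrow> nowhere_dense S"
  unfolding nowhere_dense_def by (metis closure_mono interior_mono subset_empty)

lemma codimension_le_1_if_nowhere_dense:
  fixes K :: "(real^'n) set"
  assumes "compact K" "K \<subseteq> unit_cube" "meets_all_flats k K" "k < CARD('n)"
    and "nowhere_dense (fold_sumset (CARD('n) - 1) K)"
  shows "k = CARD('n) - 1"
proof (rule ccontr)
  assume "k \<noteq> CARD('n) - 1"
  then have "interior (fold_sumset (CARD('n) - 1) K) \<noteq> {}"
    using assms by (intro interior_fold_sumset_if_meets_all_flats) auto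
  then show False
    using assms(5) interior_mono[OF closure_subset] unfolding nowhere_dense_def by blast
qed

section \<open>The planar set\<close>

text \<open>
  The period is 18. The last three lines are a bottom and a top edge joined by an upright with a bulge, the
  first two lines are hooks at the left corners. The point \<open>(11,9)\<close> is missed by the sums because the reflection
  \<open>p \<mapsto> (11,9) - p\<close> moves the upright into the slots between the edges and the hooks.
\<close>
definition planar_boxes :: "(int \<times> int \<times> int \<times> int) list" where
  "planar_boxes =
    [(0,0,0,4), (0,4,4,4),
     (0,0,14,18), (0,4,14,14),
     (2,2,0,2), (2,18,0,0),
     (6,6,0,6), (6,10,6,6), (10,10,6,12), (6,10,12,12), (6,6,12,18),
     (2,18,18,18), (2,2,16,18)]"

definition planar_set :: "(real \<times> real) set" where
  "planar_set = (\<Union>(a,b,c,d)\<in>set planar_boxes.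
     {real_of_int a..real_of_int b} \<times> {real_of_int c..real_of_int d})"

lemma planar_set_subset: "planar_set \<subseteq> {0..18} \<times> {0..18}"
  by (auto simp: planar_set_def planar_boxes_def)

text \<open>This places cube vertices, and points on edges in directions other than
  \<open>i0\<close> and \<open>i1\<close>, over the planar set.\<close>

lemma planar_corners: "{0, 18} \<times> {0, 18} \<subseteq> planar_set"
  by (auto simp: planar_set_def planar_boxes_def)

lemma closed_planar_set: "closed planar_set"
  unfolding planar_set_def by (intro closed_UN) (auto intro: closed_Times)

text \<open>Two boxes sum to the box whose endpoints are the sums of the endpoints, so this is a
  finite check on integers. The shifts 0 and 1 are the only candidates because all sums lie in
  \<open>[0,36]\<close> in both coordinates.\<close>

lemma planar_boxes_sum_avoids:
  "\<forall>(a,b,c,d)\<in>set planar_boxes. \<forall>(a',b',c',d')\<in>set planar_boxes. \<forall>k\<in>set [0,1]. \<forall>l\<in>set [0,1].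
     \<not> (a + a' \<le> 11 + 18 * k \<and> 11 + 18 * k \<le> b + b' \<and> c + c' \<le> 9 + 18 * l \<and> 9 + 18 * l \<le> d + d')"
  unfolding planar_boxes_def by code_simp

lemma planar_sum_avoids:
  assumes "(x, y) \<in> planar_set" "(x', y') \<in> planar_set"
    and x: "x + x' = 11 + 18 * of_int k" and y: "y + y' = 9 + 18 * of_int l"
  shows False
proof -
  obtain a b c d where B: "(a,b,c,d) \<in> set planar_boxes"
      "of_int a \<le> x" "x \<le> of_int b" "of_int c \<le> y" "y \<le> of_int d"
    using assms(1) by (auto simp: planar_set_def)
  obtain a' b' c' d' where B': "(a',b',c',d') \<in> set planar_boxes"
      "of_int a' \<le> x'" "x' \<le> of_int b'" "of_int c' \<le> y'" "y' \<le> of_int d'"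
    using assms(2) by (auto simp: planar_set_def)
  have "(x, y) \<in> {0..18} \<times> {0..18}" "(x', y') \<in> {0..18} \<times> {0..18}"
    using assms(1,2) planar_set_subset by blast+
  then have "0 \<le> x + x'" "x + x' \<le> 36" "0 \<le> y + y'" "y + y' \<le> 36"
    by auto
  then have "- 11 \<le> 18 * real_of_int k" "18 * real_of_int k \<le> 25"
    "- 9 \<le> 18 * real_of_int l" "18 * real_of_int l \<le> 27"
    using x y by auto
  then have kl: "k \<in> set [0,1]" "l \<in> set [0,1]"
    by auto
  have "real_of_int (a + a') \<le> real_of_int (11 + 18 * k)" "real_of_int (11 + 18 * k) \<le> real_of_int (b + b')"
    "real_of_int (c + c') \<le> real_of_int (9 + 18 * l)" "real_of_int (9 + 18 * l) \<le> real_of_int (d + d')"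
    using B B' x y by (simp_all del: of_int_le_iff)
  then have "a + a' \<le> 11 + 18 * k \<and> 11 + 18 * k \<le> b + b' \<and> c + c' \<le> 9 + 18 * l \<and> 9 + 18 * l \<le> d + d'"
    by (simp only: of_int_le_iff)
  then show False
    using planar_boxes_sum_avoids B(1) B'(1) kl by fast
qed

lemma same_side_of_hyperplane:
  fixes S :: "'a::euclidean_space set"
  assumes "connected S" "p \<in> S" "q \<in> S" "\<And>z. z \<in> S \<Longrightarrow> u \<bullet> z \<noteq> t"
  shows "u \<bullet> p < t \<longleftrightarrow> u \<bullet> q < t"
  using assms connected_ivt_hyperplane[of S p q u t] connected_ivt_hyperplane[of S q p u t]
  by (meson linear not_le)

text \<open>
  \<open>planar_set\<close> has three components, but \<open>(2,2)\<close>, a point of the largest one, is the midpoint of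
  \<open>(0,0)\<close> and \<open>(4,4)\<close>, which lie in another one; so a line that avoids both components has them on the
  same side. The third component is the mirror image of the second.
\<close>
lemma planar_corners_same_side:
  assumes avoid: "\<And>z. z \<in> planar_set \<Longrightarrow> u \<bullet> z \<noteq> t"
    and "p \<in> {0, 18} \<times> {0, 18}" "q \<in> {0, 18} \<times> {0, 18}"
  shows "u \<bullet> p < t \<longleftrightarrow> u \<bullet> q < t"
proof -
  have box: "u \<bullet> (x, y) < t \<longleftrightarrow> u \<bullet> (x', y') < t"
    if ex_box: "\<exists>(a,b,c,d)\<in>set planar_boxes. {x, x'} \<subseteq> {real_of_int a..real_of_int b} \<and> {y, y'} \<subseteq> {real_of_int c..real_of_int d}"
    for x y x' y'
  proof -
    obtain B where "B \<in> set planar_boxes" "case B of (a,b,c,d) \<Rightarrow>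
        {x, x'} \<subseteq> {real_of_int a..real_of_int b} \<and> {y, y'} \<subseteq> {real_of_int c..real_of_int d}"
      using ex_box by blast
    then obtain a b c d where abcd: "(a,b,c,d) \<in> set planar_boxes"
        "{x, x'} \<subseteq> {real_of_int a..real_of_int b}" "{y, y'} \<subseteq> {real_of_int c..real_of_int d}"
      by (cases B rule: prod_cases4) simp
    show ?thesis
    proof (rule same_side_of_hyperplane)
      show "connected ({real_of_int a..real_of_int b} \<times> {real_of_int c..real_of_int d})"
        by (intro convex_connected convex_Times) auto
      show "u \<bullet> z \<noteq> t" if "z \<in> {real_of_int a..real_of_int b} \<times> {real_of_int c..real_of_int d}" for z
        using avoid[of z] that abcd(1) by (force simp: planar_set_def)
    qed (use abcd in auto)
  qed
  let ?P = "\<lambda>x y. u \<bullet> (x, y) < t"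
  \<comment> \<open>Consecutive points share a box. The first chain runs through the largest
    component from \<open>(2,2)\<close> to \<open>(2,16)\<close>, passing the corners
    \<open>(18,0)\<close> and \<open>(18,18)\<close>.\<close>
  have tail: "?P 2 2 \<longleftrightarrow> ?P 2 0" "?P 2 0 \<longleftrightarrow> ?P 18 0" "?P 18 0 \<longleftrightarrow> ?P 6 0"
    "?P 6 0 \<longleftrightarrow> ?P 6 6" "?P 6 6 \<longleftrightarrow> ?P 10 6" "?P 10 6 \<longleftrightarrow> ?P 10 12" "?P 10 12 \<longleftrightarrow> ?P 6 12"
    "?P 6 12 \<longleftrightarrow> ?P 6 18" "?P 6 18 \<longleftrightarrow> ?P 18 18" "?P 18 18 \<longleftrightarrow> ?P 2 18" "?P 2 18 \<longleftrightarrow> ?P 2 16"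
    and hooks: "?P 0 0 \<longleftrightarrow> ?P 0 4" "?P 0 4 \<longleftrightarrow> ?P 4 4" "?P 0 18 \<longleftrightarrow> ?P 0 14" "?P 0 14 \<longleftrightarrow> ?P 4 14"
    by (rule box; simp add: planar_boxes_def)+
  have mid: "2 * (u \<bullet> (2, 2)) = u \<bullet> (0, 0) + u \<bullet> (4, 4)"
    "2 * (u \<bullet> (2, 16)) = u \<bullet> (0, 18) + u \<bullet> (4, 14)"
    by (cases u; simp)+
  have "?P 2 2 \<longleftrightarrow> ?P 0 0"
    using hooks(1,2) mid(1) by (smt (verit))
  moreover have "?P 2 16 \<longleftrightarrow> ?P 0 18"
    using hooks(3,4) mid(2) by (smt (verit))
  ultimately have "?P x y \<longleftrightarrow> ?P 0 0" if "x \<in> {0, 18}" "y \<in> {0, 18}" for x y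
    using tail that by auto
  then show ?thesis using assms(2,3) by auto
qed

section \<open>The seed in dimension d\<close>

text \<open>Stated with equations, so that rescaling and translating the set only change
  \<open>t\<close>. The case \<open>u = 0\<close> asks that \<open>K\<close> be nonempty.\<close>

definition meets_all_hyperplanes :: "(real^'n) set \<Rightarrow> bool" where
  "meets_all_hyperplanes K \<longleftrightarrow>
     (\<forall>u t. (\<exists>x\<in>unit_cube. u \<bullet> x = t) \<longrightarrow> (\<exists>x\<in>K. u \<bullet> x = t))"

lemma meets_all_flats_hyperplanes:
  fixes K :: "(real^'n) set"
  assumes "meets_all_hyperplanes K"
  shows "meets_all_flats (CARD('n) - 1) K"
  unfolding meets_all_flats_def
proof (intro allI impI, elim conjE)
  fix S :: "(real^'n) set"
  assume S: "affine S" "aff_dim S = int (CARD('n) - 1)" "S \<inter> unit_cube \<noteq> {}"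
  then have "aff_dim S = int (DIM(real^'n) - 1)" by simp
  then obtain u t where "affine hull S = {x. u \<bullet> x = t}"
    unfolding aff_dim_eq_hyperplane by blast
  then have "S = {x. u \<bullet> x = t}"
    using S(1) by (simp add: hull_same)
  then show "K \<inter> S \<noteq> {}"
    using S(3) assms unfolding meets_all_hyperplanes_def by blast
qed

definition cube_vertex :: "'n set \<Rightarrow> real^'n" where
  "cube_vertex A = (\<chi> i. if i \<in> A then 1 else 0)"

lemma cube_vertex_nth [simp]: "cube_vertex A $ i = (if i \<in> A then 1 else 0)"
  by (simp add: cube_vertex_def)

text \<open>A linear functional on the cube is extremal at vertices, so a hyperplane meeting the
  cube but no vertex separates two vertices. Walking along edges, it then separates the ends of some
  edge.\<close>

lemma meets_all_hyperplanesI: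
  fixes K :: "(real^'n) set"
  assumes vertices: "range cube_vertex \<subseteq> K"
    and edges: "\<And>u t j A. (\<And>x. x \<in> K \<Longrightarrow> u \<bullet> x \<noteq> t) \<Longrightarrow> j \<notin> A \<Longrightarrow>
      u \<bullet> cube_vertex A < t \<longleftrightarrow> u \<bullet> cube_vertex (insert j A) < t"
  shows "meets_all_hyperplanes K"
  unfolding meets_all_hyperplanes_def
proof (intro allI impI, rule ccontr)
  fix u t assume "\<exists>x\<in>unit_cube. u \<bullet> x = t" and "\<not> (\<exists>x\<in>K. u \<bullet> x = t)"
  then obtain x where x: "x \<in> unit_cube" "u \<bullet> x = t" and avoid: "\<And>x. x \<in> K \<Longrightarrow> u \<bullet> x \<noteq> t"
    by blast
  have same: "u \<bullet> cube_vertex A < t \<longleftrightarrow> u \<bullet> cube_vertex {} < t" for A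
  proof (induction A rule: finite_induct[OF finite])
    case (2 j A)
    then show ?case using edges[OF avoid, of j A] by simp
  qed simp
  have x01: "0 \<le> x $ i" "x $ i \<le> 1" for i
    using x(1) by (auto simp: unit_cube_def)
  \<comment> \<open>The vertices that maximise and minimise the functional are read off from the
    signs of the components of \<open>u\<close>.\<close>
  have "u \<bullet> x \<le> u \<bullet> cube_vertex {i. 0 < u $ i}"
    unfolding inner_vec_def using x01
    by (intro sum_mono) (auto simp: mult_left_le mult_nonpos_nonneg)
  moreover have "u \<bullet> cube_vertex {i. u $ i < 0} \<le> u \<bullet> x"
    unfolding inner_vec_def
  proof (intro sum_mono)
    fix i show "u $ i \<bullet> cube_vertex {i. u $ i < 0} $ i \<le> u $ i \<bullet> x $ i"
      using x01[of i] mult_left_mono_neg[of "x $ i" 1 "u $ i"] by auto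
  qed
  moreover have "u \<bullet> cube_vertex {i. u $ i < 0} \<noteq> t"
    using avoid vertices by blast
  ultimately show False
    using same[of "{i. 0 < u $ i}"] same[of "{i. u $ i < 0}"] x(2) by auto
qed

text \<open>The first part puts a copy of the planar set, scaled by \<open>1/18\<close>, into every
  2-face parallel to the \<open>i0\<close>-\<open>i1\<close> plane. The second part consists of all
  cube edges in the other directions.\<close>

definition seed :: "'n \<Rightarrow> 'n \<Rightarrow> (real^'n) set" where
  "seed i0 i1 =
     {x \<in> unit_cube. (18 * x $ i0, 18 * x $ i1) \<in> planar_set \<and>
        (\<forall>i. i \<noteq> i0 \<and> i \<noteq> i1 \<longrightarrow> x $ i \<in> {0,1})} \<union>
     {x \<in> unit_cube. \<exists>j. j \<noteq> i0 \<and> j \<noteq> i1 \<and> (\<forall>i. i \<noteq> j \<longrightarrow> x $ i \<in> {0,1})}"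

lemma seed_cases:
  assumes "x \<in> seed i0 i1"
  obtains (planar) "(18 * x $ i0, 18 * x $ i1) \<in> planar_set"
      "\<And>i. i \<noteq> i0 \<Longrightarrow> i \<noteq> i1 \<Longrightarrow> x $ i \<in> {0,1}"
    | (edge) j where "j \<noteq> i0" "j \<noteq> i1" "\<And>i. i \<noteq> j \<Longrightarrow> x $ i \<in> {0,1}"
  using assms unfolding seed_def by blast

lemma seed_subset: "seed i0 i1 \<subseteq> unit_cube"
  by (auto simp: seed_def)

lemma compact_seed:
  fixes i0 i1 :: "'n::finite"
  shows "compact (seed i0 i1)"
proof -
  let ?P = "{x :: real^'n. (18 * x $ i0, 18 * x $ i1) \<in> planar_set}"
  let ?B = "\<lambda>i. {x :: real^'n. x $ i \<in> {0,1}}"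
  have "closed ((\<lambda>x :: real^'n. (18 * x $ i0, 18 * x $ i1)) -` planar_set)"
    by (intro closed_vimage closed_planar_set continuous_intros)
  then have "closed ?P" by (simp add: vimage_def)
  moreover have "closed ((\<lambda>x :: real^'n. x $ i) -` {0,1})" for i
    by (intro closed_vimage continuous_intros)
  then have "closed (?B i)" for i by (simp add: vimage_def)
  ultimately have "closed (?P \<inter> (\<Inter>i\<in>UNIV - {i0,i1}. ?B i) \<union> (\<Union>j\<in>UNIV - {i0,i1}. \<Inter>i\<in>UNIV - {j}. ?B i))"
    by (intro closed_Un closed_Int closed_INT closed_UN) auto
  then have "compact (unit_cube \<inter> (?P \<inter> (\<Inter>i\<in>UNIV - {i0,i1}. ?B i) \<union> (\<Union>j\<in>UNIV - {i0,i1}. \<Inter>i\<in>UNIV - {j}. ?B i)))"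
    by (rule compact_Int_closed[OF compact_unit_cube])
  also have "unit_cube \<inter> (?P \<inter> (\<Inter>i\<in>UNIV - {i0,i1}. ?B i) \<union> (\<Union>j\<in>UNIV - {i0,i1}. \<Inter>i\<in>UNIV - {j}. ?B i)) = seed i0 i1"
    by (auto simp: seed_def)
  finally show ?thesis .
qed

lemma seed_planar:
  assumes "i0 \<noteq> i1" "x \<in> seed i0 i1"
  shows "(18 * x $ i0, 18 * x $ i1) \<in> planar_set"
  using assms(2)
proof (cases rule: seed_cases)
  case (edge j)
  from edge(3)[of i0] edge(3)[of i1] edge(1,2)
  have "(18 * x $ i0, 18 * x $ i1) \<in> {0, 18} \<times> {0, 18}" by auto
  then show ?thesis using planar_corners by blast
qed

text \<open>In a planar copy coordinate \<open>j\<close> is 0 or 1, so a nonintegral value puts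
  \<open>x\<close> on an edge in direction \<open>j\<close>.\<close>

lemma seed_edge_direction:
  assumes "x \<in> seed i0 i1" "x $ j \<notin> \<int>" "j \<noteq> i0" "j \<noteq> i1" "i \<noteq> j"
  shows "x $ i \<in> \<int>"
proof -
  have j: "x $ j \<notin> {0,1}"
    using assms(2) by auto
  from assms(1) have "x $ i \<in> {0,1}"
  proof (cases rule: seed_cases)
    case planar
    from planar(2)[OF assms(3,4)] j show ?thesis by simp
  next
    case (edge j')
    from edge(3)[of j] j have "j = j'" by blast
    with edge(3) assms(5) show ?thesis by blast
  qed
  then show ?thesis by auto
qed

lemma cube_vertex_in_seed: "cube_vertex A \<in> seed i0 i1"
  using planar_corners by (force simp: seed_def unit_cube_def)

lemma meets_all_hyperplanes_seed:
  fixes i0 i1 :: "'n::finite"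
  assumes "i0 \<noteq> i1"
  shows "meets_all_hyperplanes (seed i0 i1)"
proof (rule meets_all_hyperplanesI)
  show "range cube_vertex \<subseteq> seed i0 i1"
    using cube_vertex_in_seed by blast
next
  fix u :: "real^'n" and t and j :: 'n and A
  assume avoid: "\<And>x. x \<in> seed i0 i1 \<Longrightarrow> u \<bullet> x \<noteq> t" and "j \<notin> A"
  show "u \<bullet> cube_vertex A < t \<longleftrightarrow> u \<bullet> cube_vertex (insert j A) < t"
  proof (cases "j = i0 \<or> j = i1")
    case False
    show ?thesis
    proof (rule same_side_of_hyperplane)
      show "u \<bullet> z \<noteq> t" if z: "z \<in> closed_segment (cube_vertex A) (cube_vertex (insert j A))" for z
      proof (rule avoid)
        obtain s where s: "0 \<le> s" "s \<le> 1"
            "z = (1 - s) *\<^sub>R cube_vertex A + s *\<^sub>R cube_vertex (insert j A)"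
          using z by (auto simp: closed_segment_def)
        then have z_nth: "z $ i = (if i = j then s else cube_vertex A $ i)" for i
          using \<open>j \<notin> A\<close> by simp
        then have "z \<in> unit_cube"
          using s(1,2) by (simp add: unit_cube_def)
        moreover have "\<forall>i. i \<noteq> j \<longrightarrow> z $ i \<in> {0,1}"
          by (simp add: z_nth)
        ultimately show "z \<in> seed i0 i1"
          using False unfolding seed_def by blast
      qed
    qed auto
  next
    case True
    \<comment> \<open>\<open>E\<close> maps the square of side 18 affinely onto the 2-face through
      \<open>cube_vertex A\<close>. Both ends of the edge are images of corners, and the hyperplane
      pulls back to the equation of a line avoiding \<open>planar_set\<close>.\<close>
    define E where "E x y = (\<chi> i. if i = i0 then x / 18 else if i = i1 then y / 18 else cube_vertex A $ i)" for x y
    have E: "E x y \<in> seed i0 i1" if "(x, y) \<in> planar_set" for x y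
    proof -
      have "0 \<le> x" "x \<le> 18" "0 \<le> y" "y \<le> 18"
        using that planar_set_subset by auto
      then have "E x y \<in> unit_cube"
        by (simp add: E_def unit_cube_def)
      moreover have "(18 * E x y $ i0, 18 * E x y $ i1) \<in> planar_set"
        using that assms by (simp add: E_def)
      moreover have "\<forall>i. i \<noteq> i0 \<and> i \<noteq> i1 \<longrightarrow> E x y $ i \<in> {0,1}"
        by (simp add: E_def)
      ultimately show ?thesis
        unfolding seed_def by blast
    qed
    have E_inner: "u \<bullet> E x y = u \<bullet> E 0 0 + (u $ i0 / 18, u $ i1 / 18) \<bullet> (x, y)" for x y
    proof -
      have "E x y = E 0 0 + (x / 18) *\<^sub>R axis i0 1 + (y / 18) *\<^sub>R axis i1 1"
        using assms by (auto simp: E_def vec_eq_iff axis_def)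
      then have "u \<bullet> E x y = u \<bullet> (E 0 0 + (x / 18) *\<^sub>R axis i0 1 + (y / 18) *\<^sub>R axis i1 1)"
        by (simp only:)
      then show ?thesis
        by (simp add: inner_add_right inner_axis mult.commute)
    qed
    have E_vertex: "\<exists>x\<in>{0, 18}. \<exists>y\<in>{0, 18}. cube_vertex B = E x y"
      if "B \<subseteq> insert j A" "A \<subseteq> B" for B
    proof (intro bexI)
      show "cube_vertex B = E (18 * cube_vertex B $ i0) (18 * cube_vertex B $ i1)"
        using that True by (auto simp: E_def vec_eq_iff)
    qed auto
    have "(u $ i0 / 18, u $ i1 / 18) \<bullet> p < t - u \<bullet> E 0 0 \<longleftrightarrow> (u $ i0 / 18, u $ i1 / 18) \<bullet> q < t - u \<bullet> E 0 0"
      if "p \<in> {0, 18} \<times> {0, 18}" "q \<in> {0, 18} \<times> {0, 18}" for p q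
    proof (rule planar_corners_same_side[OF _ that])
      fix z assume "z \<in> planar_set"
      then show "(u $ i0 / 18, u $ i1 / 18) \<bullet> z \<noteq> t - u \<bullet> E 0 0"
        using avoid[OF E, of "fst z" "snd z"] E_inner[of "fst z" "snd z"] by auto
    qed
    then have E_same: "u \<bullet> E x y < t \<longleftrightarrow> u \<bullet> E x' y' < t"
      if "x \<in> {0, 18}" "y \<in> {0, 18}" "x' \<in> {0, 18}" "y' \<in> {0, 18}" for x y x' y'
      unfolding E_inner[of x y] E_inner[of x' y'] less_diff_eq[symmetric] add.commute[of "u \<bullet> E 0 0"]
      using that by blast
    obtain x y where "x \<in> {0, 18}" "y \<in> {0, 18}" "cube_vertex A = E x y"
      using E_vertex[of A] by blast
    moreover obtain x' y' where "x' \<in> {0, 18}" "y' \<in> {0, 18}" "cube_vertex (insert j A) = E x' y'"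
      using E_vertex[of "insert j A"] by blast
    ultimately show ?thesis
      using E_same[of x y x' y'] by simp
  qed
qed

text \<open>In the coordinates \<open>i0\<close> and \<open>i1\<close> this is the rescaled planar
  point \<open>(11,9)/18\<close>. The value \<open>1/2\<close> serves elsewhere as a nonintegral
  number.\<close>

definition gap :: "'n \<Rightarrow> real^'n" where
  "gap i0 = (\<chi> i. if i = i0 then 11/18 else 1/2)"

text \<open>
  A half-integral coordinate \<open>j\<close> requires a summand on an edge in direction \<open>j\<close>; these summands are
  integral in the coordinates \<open>i0\<close> and \<open>i1\<close>, which leaves only two summands for the planar problem.
\<close>
lemma seed_sum_avoids_gap:
  fixes f :: "nat \<Rightarrow> real^'n"
  assumes i01: "i0 \<noteq> i1" and f: "\<And>s. s < CARD('n) \<Longrightarrow> f s \<in> seed i0 i1" and z: "\<And>i. z $ i \<in> \<int>"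
  shows "(\<Sum>s<CARD('n). f s) + z \<noteq> gap i0"
proof
  assume eq: "(\<Sum>s<CARD('n). f s) + z = gap i0"
  have coord: "(\<Sum>s<CARD('n). f s $ i) + z $ i = (if i = i0 then 11/18 else 1/2)" for i
    using arg_cong[OF eq, of "\<lambda>x. x $ i"] by (simp add: gap_def)
  define J where "J = UNIV - {i0, i1}"
  have half: "(1/2 :: real) \<notin> \<int>"
  proof
    assume "(1/2 :: real) \<in> \<int>"
    then obtain m where "(1/2 :: real) = of_int m" by (elim Ints_cases)
    then have "real_of_int (2 * m) = real_of_int 1" by simp
    then have "2 * m = 1" by (simp only: of_int_eq_iff)
    then show False by presburger
  qed
  have "\<exists>s<CARD('n). f s $ j \<notin> \<int>" if "j \<in> J" for j
  proof (rule ccontr)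
    assume "\<not> ?thesis"
    then have "(\<Sum>s<CARD('n). f s $ j) + z $ j \<in> \<int>"
      by (intro Ints_add Ints_sum z) auto
    with that half show False unfolding coord by (auto simp: J_def)
  qed
  then obtain \<sigma> where \<sigma>: "\<And>j. j \<in> J \<Longrightarrow> \<sigma> j < CARD('n) \<and> f (\<sigma> j) $ j \<notin> \<int>"
    by metis
  have int: "f (\<sigma> j) $ i \<in> \<int>" if "j \<in> J" "i \<noteq> j" for i j
    using seed_edge_direction[OF f, of "\<sigma> j" j i] \<sigma>[of j] that by (auto simp: J_def)
  \<comment> \<open>A summand that is nonintegral in a direction of \<open>J\<close> is integral in
    all others, so distinct directions use distinct summands. This takes \<open>d - 2\<close> of the
    \<open>d\<close> summands and leaves \<open>p\<close> and \<open>q\<close>.\<close>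
  then have "inj_on \<sigma> J"
    using \<sigma> by (metis inj_onI)
  then have "card (\<sigma> ` J) = CARD('n) - 2"
    using i01 by (simp add: card_image J_def card_Diff_subset)
  moreover have sub: "\<sigma> ` J \<subseteq> {..<CARD('n)}" using \<sigma> by auto
  moreover have "2 \<le> CARD('n)"
    using i01 card_mono[of UNIV "{i0, i1}"] by simp
  ultimately have "card ({..<CARD('n)} - \<sigma> ` J) = 2"
    by (simp add: card_Diff_subset finite_subset[OF sub])
  then obtain p q where pq: "{..<CARD('n)} - \<sigma> ` J = {p, q}" "p \<noteq> q"
    by (auto simp: card_2_iff)
  then have pq_less: "p < CARD('n)" "q < CARD('n)" by auto
  have "\<exists>k. 18 * f p $ i + 18 * f q $ i = (if i = i0 then 11 else 9) + 18 * of_int k" if "i \<notin> J" for i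
  proof -
    have "f s $ i \<in> \<int>" if "s \<in> \<sigma> ` J" for s
      using int[of _ i] \<open>i \<notin> J\<close> that by (metis imageE)
    then have "(\<Sum>s\<in>\<sigma> ` J. f s $ i) + z $ i \<in> \<int>"
      by (intro Ints_add Ints_sum z)
    then obtain m where m: "(\<Sum>s\<in>\<sigma> ` J. f s $ i) + z $ i = of_int m"
      by (elim Ints_cases)
    have "(\<Sum>s<CARD('n). f s $ i) = (\<Sum>s\<in>{p, q}. f s $ i) + (\<Sum>s\<in>\<sigma> ` J. f s $ i)"
      using sum.subset_diff[OF sub, of "\<lambda>s. f s $ i"] pq(1) by simp
    then have "f p $ i + f q $ i + of_int m = (if i = i0 then 11/18 else 1/2)"
      using coord[of i] m pq(2) by simp
    then show ?thesis
      by (intro exI[of _ "- m"]) (auto split: if_splits)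
  qed
  from this[of i0] this[of i1] obtain k l where
    "18 * f p $ i0 + 18 * f q $ i0 = 11 + 18 * of_int k"
    "18 * f p $ i1 + 18 * f q $ i1 = 9 + 18 * of_int l"
    using i01 by (auto simp: J_def)
  then show False
    using planar_sum_avoids seed_planar[OF i01 f] pq_less by blast
qed

section \<open>Self-similar sets\<close>

lemma finite_vec_set:
  assumes "finite A"
  shows "finite {x :: 'a^'n. \<forall>i. x $ i \<in> A}"
proof (rule finite_subset)
  show "{x :: 'a^'n. \<forall>i. x $ i \<in> A} \<subseteq> vec_lambda ` (UNIV \<rightarrow>\<^sub>E A)"
  proof
    fix x :: "'a^'n" assume "x \<in> {x. \<forall>i. x $ i \<in> A}"
    then have "($) x \<in> UNIV \<rightarrow>\<^sub>E A" by auto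
    moreover have "x = vec_lambda (($) x)" by simp
    ultimately show "x \<in> vec_lambda ` (UNIV \<rightarrow>\<^sub>E A)" by blast
  qed
  show "finite (vec_lambda ` (UNIV \<rightarrow>\<^sub>E A :: ('n \<Rightarrow> 'a) set))"
    using assms by (intro finite_imageI finite_PiE) auto
qed

definition grid_digits :: "nat \<Rightarrow> (real^'n) set" where
  "grid_digits m = {a. \<forall>i. a $ i \<in> of_nat ` {..<m}}"

lemma finite_grid_digits: "finite (grid_digits m)"
  unfolding grid_digits_def by (rule finite_vec_set) simp

text \<open>A union of cubes of side \<open>1/m^n\<close>, described by the first \<open>n\<close>
  digits in base \<open>m\<close>. The recursion prepends the leading digit.\<close>

primrec digit_approx :: "nat \<Rightarrow> (real^'n) set \<Rightarrow> nat \<Rightarrow> (real^'n) set" where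
  "digit_approx m D 0 = unit_cube"
| "digit_approx m D (Suc n) = (\<Union>a\<in>D. (\<lambda>x. (1 / real m) *\<^sub>R (a + x)) ` digit_approx m D n)"

lemma compact_digit_approx:
  assumes "D \<subseteq> grid_digits m"
  shows "compact (digit_approx m D n)"
proof (induction n)
  case 0
  then show ?case by (simp add: compact_unit_cube)
next
  case (Suc n)
  have "finite D"
    using assms finite_grid_digits finite_subset by blast
  with Suc show ?case
    by (auto intro!: compact_UN compact_continuous_image continuous_intros)
qed

lemma digit_approx_Suc_subset:
  assumes "D \<subseteq> grid_digits m" "0 < m"
  shows "digit_approx m D (Suc n) \<subseteq> digit_approx m D n"
proof (induction n)
  case 0
  have "(1 / real m) *\<^sub>R (a + x) \<in> unit_cube" if "a \<in> D" "x \<in> unit_cube" for a x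
    unfolding unit_cube_def
  proof (intro CollectI allI)
    fix i
    obtain k where k: "a $ i = real k" "k < m"
      using \<open>a \<in> D\<close> assms(1) unfolding grid_digits_def by blast
    then have "real k + 1 \<le> real m" by linarith
    moreover have "0 \<le> x $ i" "x $ i \<le> 1"
      using that by (auto simp: unit_cube_def)
    ultimately show "0 \<le> ((1 / real m) *\<^sub>R (a + x)) $ i \<and> ((1 / real m) *\<^sub>R (a + x)) $ i \<le> 1"
      using k assms(2) by (simp add: field_simps)
  qed
  then show ?case by auto
next
  case (Suc n)
  then show ?case by (simp only: digit_approx.simps) blast
qed

text \<open>A hyperplane through \<open>(a + x) / m\<close> with \<open>x\<close> in the cube is the
  rescaling of a parallel one through \<open>x\<close>, which by induction meets the previous
  iterate at some \<open>y\<close>; then \<open>(a + y) / m\<close> lies on the original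
  hyperplane.\<close>

lemma meets_all_hyperplanes_digit_approx:
  fixes D :: "(real^'n) set"
  assumes "meets_all_hyperplanes (digit_approx m D 1)" "0 < m"
  shows "meets_all_hyperplanes (digit_approx m D n)"
proof (induction n)
  case 0
  then show ?case by (auto simp: meets_all_hyperplanes_def)
next
  case (Suc n)
  show ?case
    unfolding meets_all_hyperplanes_def
  proof (intro allI impI)
    fix u :: "real^'n" and t assume "\<exists>x\<in>unit_cube. u \<bullet> x = t"
    then have "\<exists>x\<in>digit_approx m D 1. u \<bullet> x = t"
      using assms(1) by (auto simp: meets_all_hyperplanes_def)
    then obtain a x where a: "a \<in> D" "x \<in> unit_cube" "u \<bullet> ((1 / real m) *\<^sub>R (a + x)) = t"
      by auto
    obtain y where y: "y \<in> digit_approx m D n" "u \<bullet> y = u \<bullet> x"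
      using Suc a(2) unfolding meets_all_hyperplanes_def by blast
    have "u \<bullet> ((1 / real m) *\<^sub>R (a + y)) = t"
      using a(3) y(2) by (simp add: inner_add_right)
    with a(1) y(1) show "\<exists>x\<in>digit_approx m D (Suc n). u \<bullet> x = t"
      by auto
  qed
qed

text \<open>Multiplication by \<open>m^n\<close> moves the first \<open>n\<close> digits into the
  integral part \<open>z\<close>. Starting from level \<open>Suc n\<close> leaves one more digit,
  which puts the remainder in the first iterate.\<close>

lemma digit_approx_Suc_lattice:
  assumes "D \<subseteq> grid_digits m" "0 < m" "y \<in> digit_approx m D (Suc n)"
  shows "\<exists>z x. (\<forall>i. z $ i \<in> \<int>) \<and> x \<in> digit_approx m D 1 \<and> real m ^ n *\<^sub>R y = z + x"
  using assms(3)
proof (induction n arbitrary: y)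
  case 0
  then show ?case by (intro exI[of _ 0] exI[of _ y]) simp
next
  case (Suc n)
  then obtain a y' where a: "a \<in> D" "y = (1 / real m) *\<^sub>R (a + y')" "y' \<in> digit_approx m D (Suc n)"
    by (auto simp only: digit_approx.simps(2)[of m D "Suc n"])
  then obtain z x where z: "\<forall>i. z $ i \<in> \<int>" "x \<in> digit_approx m D 1" "real m ^ n *\<^sub>R y' = z + x"
    using Suc.IH by blast
  have "real m ^ Suc n *\<^sub>R y = real m ^ n *\<^sub>R (a + y')"
    using assms(2) by (simp add: a(2))
  also have "\<dots> = (real m ^ n *\<^sub>R a + z) + x"
    using z(3) by (simp add: scaleR_add_right add.assoc)
  finally have "real m ^ Suc n *\<^sub>R y = (real m ^ n *\<^sub>R a + z) + x" .
  moreover have "(real m ^ n *\<^sub>R a + z) $ i \<in> \<int>" for i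
  proof -
    have "a $ i \<in> of_nat ` {..<m}"
      using a(1) assms(1) unfolding grid_digits_def by blast
    then have "a $ i \<in> \<int>" by auto
    moreover have "real m ^ n \<in> \<int>" by simp
    ultimately show ?thesis using z(1) by simp
  qed
  ultimately show ?case using z(2) by blast
qed

definition digit_set :: "nat \<Rightarrow> (real^'n) set \<Rightarrow> (real^'n) set" where
  "digit_set m D = (\<Inter>n. digit_approx m D n)"

lemma digit_set_subset: "digit_set m D \<subseteq> unit_cube"
  unfolding digit_set_def using digit_approx.simps(1) by blast

lemma compact_digit_set:
  assumes "D \<subseteq> grid_digits m"
  shows "compact (digit_set m D)"
proof -
  have "closed (digit_set m D)"
    unfolding digit_set_def using compact_digit_approx[OF assms]
    by (intro closed_INT) (auto intro: compact_imp_closed)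
  then show ?thesis
    using compact_Int_closed[OF compact_unit_cube] digit_set_subset by (metis inf.absorb2)
qed

text \<open>The sections of the iterates by a hyperplane are nonempty, compact and nested, so they
  have a common point.\<close>

lemma meets_all_hyperplanes_digit_set:
  fixes D :: "(real^'n) set"
  assumes D: "D \<subseteq> grid_digits m" "0 < m" and M: "meets_all_hyperplanes (digit_approx m D 1)"
  shows "meets_all_hyperplanes (digit_set m D)"
  unfolding meets_all_hyperplanes_def
proof (intro allI impI)
  fix u :: "real^'n" and t assume "\<exists>x\<in>unit_cube. u \<bullet> x = t"
  then have nonempty: "digit_approx m D n \<inter> {x. u \<bullet> x = t} \<noteq> {}" for n
    using meets_all_hyperplanes_digit_approx[OF M D(2), of n]
    unfolding meets_all_hyperplanes_def by blast
  have "(\<Inter>n. digit_approx m D n \<inter> {x. u \<bullet> x = t}) \<noteq> {}"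
  proof (rule compact_nest)
    show "compact (digit_approx m D n \<inter> {x. u \<bullet> x = t})" for n
      by (intro compact_Int_closed compact_digit_approx D closed_hyperplane)
    show "digit_approx m D n' \<inter> {x. u \<bullet> x = t} \<subseteq> digit_approx m D n \<inter> {x. u \<bullet> x = t}" if "n \<le> n'" for n n'
      using lift_Suc_antimono_le[of "digit_approx m D", OF digit_approx_Suc_subset[OF D] that] by blast
  qed (rule nonempty)
  then show "\<exists>x\<in>digit_set m D. u \<bullet> x = t"
    unfolding digit_set_def by blast
qed

lemma norm_le_of_components:
  fixes x :: "real^'n"
  assumes "\<And>i. \<bar>x $ i\<bar> \<le> e"
  shows "norm x \<le> real CARD('n) * e"
  using norm_le_l1_cart[of x] sum_bounded_above[of UNIV "\<lambda>i. \<bar>x $ i\<bar>" e] assms by force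

text \<open>Any ball contains a point \<open>q\<close> with \<open>m^n q\<close> in
  \<open>w + \<int>^d\<close>. If \<open>q\<close> were a sum of \<open>l\<close> points of the set,
  scaling by \<open>m^n\<close> would write \<open>w\<close> as a sum of \<open>l\<close> points of
  the first iterate plus an integral vector.\<close>

lemma nowhere_dense_fold_sumset_digit_set:
  fixes D :: "(real^'n) set"
  assumes D: "D \<subseteq> grid_digits m" "2 \<le> m"
    and avoid: "\<And>f z. (\<And>s. s < l \<Longrightarrow> f s \<in> digit_approx m D 1) \<Longrightarrow> (\<And>i. z $ i \<in> \<int>) \<Longrightarrow>
      (\<Sum>s<l. f s) + z \<noteq> w"
  shows "nowhere_dense (fold_sumset l (digit_set m D))"
proof (rule ccontr)
  let ?K = "digit_set m D"
  assume "\<not> ?thesis"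
  then have "interior (fold_sumset l ?K) \<noteq> {}"
    unfolding nowhere_dense_def
    using compact_imp_closed[OF compact_fold_sumset[OF compact_digit_set[OF D(1)]]] by (simp add: closure_closed)
  then obtain p e where e: "0 < e" "ball p e \<subseteq> fold_sumset l ?K"
    by (auto simp: mem_interior)
  obtain n where "real CARD('n) / e < real m ^ n"
    using D(2) real_arch_pow[of "real m"] by auto
  then have n: "real CARD('n) * (1 / real m ^ n) < e"
    using e(1) D(2) by (simp add: field_simps)
  \<comment> \<open>Rounding down puts \<open>q\<close> within \<open>1/m^n\<close> of the centre
    \<open>p\<close> in each coordinate.\<close>
  define z :: "real^'n" where "z = (\<chi> i. of_int \<lfloor>real m ^ n * p $ i - w $ i\<rfloor>)"
  define q where "q = (1 / real m ^ n) *\<^sub>R (w + z)"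
  have q: "real m ^ n *\<^sub>R q = w + z"
    using D(2) by (simp add: q_def)
  have "norm (p - q) \<le> real CARD('n) * (1 / real m ^ n)"
  proof (rule norm_le_of_components)
    fix i
    have "\<bar>real m ^ n * (p - q) $ i\<bar> = \<bar>real m ^ n * p $ i - w $ i - z $ i\<bar>"
      using arg_cong[OF q, of "\<lambda>x. x $ i"] by (simp add: algebra_simps)
    also have "\<dots> \<le> 1"
      unfolding z_def by (simp, linarith)
    finally have "\<bar>(p - q) $ i\<bar> * real m ^ n \<le> 1"
      by (simp add: abs_mult mult.commute)
    then show "\<bar>(p - q) $ i\<bar> \<le> 1 / real m ^ n"
      using D(2) by (simp add: pos_le_divide_eq)
  qed
  then have "q \<in> fold_sumset l ?K"
    using n e(2) by (auto simp: dist_norm subset_iff)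
  then obtain y where y: "q = (\<Sum>s<l. y s)" "\<forall>s<l. y s \<in> ?K"
    by (auto simp: fold_sumset_def)
  have "\<exists>z x. (\<forall>i. z $ i \<in> \<int>) \<and> x \<in> digit_approx m D 1 \<and> real m ^ n *\<^sub>R y s = z + x" if "s < l" for s
  proof (rule digit_approx_Suc_lattice[OF D(1)])
    show "0 < m" using D(2) by simp
    show "y s \<in> digit_approx m D (Suc n)"
      using y(2) that unfolding digit_set_def by blast
  qed
  then obtain zs xs where zx: "\<And>s. s < l \<Longrightarrow>
      (\<forall>i. zs s $ i \<in> \<int>) \<and> xs s \<in> digit_approx m D 1 \<and> real m ^ n *\<^sub>R y s = zs s + xs s"
    by metis
  have "w + z = (\<Sum>s<l. real m ^ n *\<^sub>R y s)"
    using q y(1) by (simp add: scaleR_sum_right)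
  also have "\<dots> = (\<Sum>s<l. zs s) + (\<Sum>s<l. xs s)"
    using zx by (simp add: sum.distrib)
  finally have "(\<Sum>s<l. xs s) + ((\<Sum>s<l. zs s) - z) = w"
    by (simp add: algebra_simps)
  moreover have "((\<Sum>s<l. zs s) - z) $ i \<in> \<int>" for i
    using zx by (auto simp: z_def intro!: Ints_diff Ints_sum)
  ultimately show False
    using avoid[of xs] zx by blast
qed

section \<open>Grid approximation of a compact set\<close>

text \<open>The indices of the closed grid cells of side \<open>1/m\<close> that meet
  \<open>S\<close>; the first iterate for these digits is the union of those cells.\<close>

definition hit_digits :: "nat \<Rightarrow> (real^'n) set \<Rightarrow> (real^'n) set" where
  "hit_digits m S = {a \<in> grid_digits m. \<exists>x\<in>unit_cube. (1 / real m) *\<^sub>R (a + x) \<in> S}"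

lemma subset_hit_digits_approx:
  assumes "S \<subseteq> unit_cube" "0 < m"
  shows "S \<subseteq> digit_approx m (hit_digits m S) 1"
proof
  fix x assume x: "x \<in> S"
  \<comment> \<open>The cap \<open>m - 1\<close> assigns points with a coordinate equal to 1 to the
    last cell.\<close>
  define k where "k i = min (nat \<lfloor>real m * x $ i\<rfloor>) (m - 1)" for i
  define a :: "real^'a" where "a = (\<chi> i. real (k i))"
  have "a \<in> grid_digits m"
    using assms(2) by (auto simp: a_def k_def grid_digits_def)
  moreover have in_cube: "real m *\<^sub>R x - a \<in> unit_cube"
    unfolding unit_cube_def
  proof (intro CollectI allI)
    fix i
    have "0 \<le> x $ i" "x $ i \<le> 1"
      using x assms(1) by (auto simp: unit_cube_def)
    then have mx: "0 \<le> real m * x $ i" "real m * x $ i \<le> real m"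
      by (simp_all add: mult_left_le)
    then have fl: "real (nat \<lfloor>real m * x $ i\<rfloor>) \<le> real m * x $ i" "real m * x $ i < real (nat \<lfloor>real m * x $ i\<rfloor>) + 1"
      by simp_all
    have "real (k i) \<le> real m * x $ i"
      using fl(1) by (simp add: k_def)
    moreover have "real m * x $ i \<le> real (k i) + 1"
      using fl(2) mx(2) assms(2) by (cases "nat \<lfloor>real m * x $ i\<rfloor> \<le> m - 1") (auto simp: k_def of_nat_diff min_def)
    ultimately show "0 \<le> (real m *\<^sub>R x - a) $ i \<and> (real m *\<^sub>R x - a) $ i \<le> 1"
      by (simp add: a_def)
  qed
  moreover have x_eq: "x = (1 / real m) *\<^sub>R (a + (real m *\<^sub>R x - a))"
    using assms(2) by simp
  ultimately have "a \<in> hit_digits m S"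
    using x unfolding hit_digits_def by (metis (mono_tags, lifting) mem_Collect_eq)
  with in_cube x_eq show "x \<in> digit_approx m (hit_digits m S) 1"
    by (simp only: One_nat_def digit_approx.simps) blast
qed

lemma hit_digits_approx_near:
  fixes S :: "(real^'n) set"
  assumes "x \<in> digit_approx m (hit_digits m S) 1"
  shows "\<exists>y\<in>S. norm (x - y) \<le> real CARD('n) * (1 / real m)"
proof -
  obtain a c where a: "a \<in> hit_digits m S" "c \<in> unit_cube" "x = (1 / real m) *\<^sub>R (a + c)"
    using assms by auto
  then obtain c' where c': "c' \<in> unit_cube" "(1 / real m) *\<^sub>R (a + c') \<in> S"
    unfolding hit_digits_def by blast
  have "norm (x - (1 / real m) *\<^sub>R (a + c')) \<le> real CARD('n) * (1 / real m)"
  proof (rule norm_le_of_components)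
    fix i
    have "\<bar>c $ i - c' $ i\<bar> \<le> 1"
      using a(2) c'(1) unfolding unit_cube_def by (smt (verit) mem_Collect_eq)
    moreover have "(x - (1 / real m) *\<^sub>R (a + c')) $ i = (1 / real m) * (c $ i - c' $ i)"
      by (simp add: a(3) algebra_simps)
    ultimately show "\<bar>(x - (1 / real m) *\<^sub>R (a + c')) $ i\<bar> \<le> 1 / real m"
      by (simp add: abs_mult divide_right_mono)
  qed
  with c'(2) show ?thesis by blast
qed

text \<open>The compact sumset plus the integer lattice is closed, so \<open>w\<close> has positive
  distance \<open>e\<close> from it. Passing to grid cells moves a sum of \<open>l\<close> points by
  at most \<open>l * d / m\<close>, which is below \<open>e\<close> for large
  \<open>m\<close>.\<close>

lemma ex_hit_digits_sum_avoids:
  fixes S :: "(real^'n) set" and l :: nat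
  assumes S: "compact S"
    and avoid: "\<And>f z. (\<And>s. s < l \<Longrightarrow> f s \<in> S) \<Longrightarrow> (\<And>i. z $ i \<in> \<int>) \<Longrightarrow> (\<Sum>s<l. f s) + z \<noteq> w"
  shows "\<exists>m\<ge>2. \<forall>f z. (\<forall>s<l. f s \<in> digit_approx m (hit_digits m S) 1) \<longrightarrow> (\<forall>i. z $ i \<in> \<int>) \<longrightarrow>
    (\<Sum>s<l. f s) + z \<noteq> w"
proof -
  define Z :: "(real^'n) set" where "Z = {z. \<forall>i. z $ i \<in> \<int>}"
  define C where "C = (\<Union>x\<in>fold_sumset l S. \<Union>z\<in>Z. {x + z})"
  have "closed ((\<lambda>z :: real^'n. z $ i) -` \<int>)" for i
    by (intro closed_vimage closed_Ints continuous_intros)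
  then have "closed Z"
    unfolding Z_def by (intro closed_Collect_all) (simp add: vimage_def)
  then have "closed C"
    unfolding C_def by (intro compact_closed_sums compact_fold_sumset S)
  moreover have "w \<notin> C"
    using avoid unfolding C_def Z_def fold_sumset_def by blast
  ultimately obtain e where e: "0 < e" "ball w e \<subseteq> - C"
    by (metis Compl_iff open_Compl open_contains_ball)
  obtain m0 where m0: "real l * real CARD('n) / e < real m0"
    using reals_Archimedean2 by blast
  define m where "m = max 2 m0"
  have m: "2 \<le> m" "real l * real CARD('n) / e < real m"
    using m0 by (auto simp: m_def)
  then have small: "real l * (real CARD('n) * (1 / real m)) < e"
    using e(1) by (simp add: field_simps)
  have "(\<Sum>s<l. f s) + z \<noteq> w"
    if f: "\<forall>s<l. f s \<in> digit_approx m (hit_digits m S) 1" and z: "\<forall>i. z $ i \<in> \<int>" for f z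
  proof
    assume w: "(\<Sum>s<l. f s) + z = w"
    have "\<exists>y\<in>S. norm (f s - y) \<le> real CARD('n) * (1 / real m)" if "s < l" for s
      using f that hit_digits_approx_near by blast
    then obtain g where g: "\<And>s. s < l \<Longrightarrow> g s \<in> S \<and> norm (f s - g s) \<le> real CARD('n) * (1 / real m)"
      by metis
    have "norm ((\<Sum>s<l. f s) - (\<Sum>s<l. g s)) \<le> (\<Sum>s<l. real CARD('n) * (1 / real m))"
      unfolding sum_subtractf[symmetric] using g by (intro sum_norm_le) auto
    then have "norm (w - ((\<Sum>s<l. g s) + z)) < e"
      using small by (simp add: w[symmetric])
    moreover have "(\<Sum>s<l. g s) + z \<in> C"
      using g z unfolding C_def Z_def fold_sumset_def by blast
    ultimately show False
      using e(2) by (auto simp: dist_norm subset_iff)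
  qed
  with m(1) show ?thesis by blast
qed

section \<open>Conclusion\<close>

text \<open>The hyperplane on which the coordinates sum to 0 touches the cube only at the
  origin.\<close>

lemma zero_in_if_meets_all_hyperplanes:
  fixes K :: "(real^'n) set"
  assumes "meets_all_hyperplanes K" "K \<subseteq> unit_cube"
  shows "0 \<in> K"
proof -
  have "(0 :: real^'n) \<in> unit_cube" by (simp add: unit_cube_def)
  then obtain x where x: "x \<in> K" "1 \<bullet> x = 0"
    using assms(1) unfolding meets_all_hyperplanes_def by (metis inner_zero_right)
  then have "(\<Sum>i\<in>UNIV. x $ i) = 0"
    by (simp add: inner_vec_def)
  moreover have "\<And>i. 0 \<le> x $ i"
    using x(1) assms(2) by (auto simp: unit_cube_def)
  ultimately have "x = 0"
    by (simp add: sum_nonneg_eq_0_iff vec_eq_iff)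
  with x(1) show ?thesis by simp
qed

lemma ex_meets_all_hyperplanes_nowhere_dense:
  assumes "CARD('n::finite) \<ge> 2"
  shows "\<exists>K :: (real^'n) set. compact K \<and> K \<subseteq> unit_cube \<and> meets_all_hyperplanes K \<and>
    nowhere_dense (fold_sumset CARD('n) K)"
proof -
  obtain i0 i1 :: 'n where i01: "i0 \<noteq> i1"
    using assms by (metis card_le_Suc0_iff_eq finite UNIV_I not_less_eq_eq numeral_2_eq_2)
  let ?S = "seed i0 i1"
  obtain m where m: "2 \<le> m" and avoid: "\<And>f z. (\<forall>s<CARD('n). f s \<in> digit_approx m (hit_digits m ?S) 1) \<Longrightarrow>
      (\<forall>i. z $ i \<in> \<int>) \<Longrightarrow> (\<Sum>s<CARD('n). f s) + z \<noteq> gap i0"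
    using ex_hit_digits_sum_avoids[OF compact_seed seed_sum_avoids_gap[OF i01]] by blast
  define D where "D = hit_digits m ?S"
  have D: "D \<subseteq> grid_digits m"
    by (auto simp: D_def hit_digits_def)
  have "meets_all_hyperplanes (digit_approx m D 1)"
    using meets_all_hyperplanes_seed[OF i01] subset_hit_digits_approx[OF seed_subset, of m i0 i1] m
    unfolding meets_all_hyperplanes_def D_def by (metis (no_types, lifting) less_le_trans pos2 subsetD)
  then have "meets_all_hyperplanes (digit_set m D)"
    using m by (intro meets_all_hyperplanes_digit_set D) auto
  moreover have "nowhere_dense (fold_sumset CARD('n) (digit_set m D))"
  proof (rule nowhere_dense_fold_sumset_digit_set[OF D m])
    show "(\<Sum>s<CARD('n). f s) + z \<noteq> gap i0"
      if "\<And>s. s < CARD('n) \<Longrightarrow> f s \<in> digit_approx m D 1" "\<And>i. z $ i \<in> \<int>" for f z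
      using avoid that unfolding D_def by blast
  qed
  ultimately show ?thesis
    using compact_digit_set[OF D] digit_set_subset by blast
qed

theorem corollary8p3:
  fixes k :: nat
  assumes "CARD('n::finite) \<ge> 2"
    and "k < CARD('n)"
  shows "(k = CARD('n) - 1 \<longleftrightarrow>
            (\<exists>K :: (real ^ 'n) set. compact K \<and> K \<subseteq> unit_cube \<and> meets_all_flats k K \<and>
               nowhere_dense (fold_sumset (CARD('n)) K)))
       \<and> (k = CARD('n) - 1 \<longleftrightarrow>
            (\<exists>K :: (real ^ 'n) set. compact K \<and> K \<subseteq> unit_cube \<and> meets_all_flats k K \<and>
               nowhere_dense (fold_sumset (CARD('n) - 1) K)))"
  (is "(?i \<longleftrightarrow> ?ii) \<and> (?i \<longleftrightarrow> ?iii)")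
proof -
  have Suc: "CARD('n) = Suc (CARD('n) - 1)" using assms by simp
  have i_ii: "?ii" if ?i
    using ex_meets_all_hyperplanes_nowhere_dense[OF assms(1)] meets_all_flats_hyperplanes that by blast
  have i_iii: "?iii" if ?i
  proof -
    obtain K :: "(real^'n) set" where K: "compact K" "K \<subseteq> unit_cube" "meets_all_hyperplanes K"
        "nowhere_dense (fold_sumset CARD('n) K)"
      using ex_meets_all_hyperplanes_nowhere_dense[OF assms(1)] by blast
    \<comment> \<open>Since 0 lies in \<open>K\<close>, the \<open>(d-1)\<close>-fold sumset is
      contained in the \<open>d\<close>-fold one.\<close>
    have "nowhere_dense (fold_sumset (CARD('n) - 1) K)"
      using fold_sumset_subset_Suc[OF zero_in_if_meets_all_hyperplanes[OF K(3,2)]] K(4) Suc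
      by (metis nowhere_dense_subset)
    with K \<open>?i\<close> show ?iii using meets_all_flats_hyperplanes by blast
  qed
  have iii_i: ?i if ?iii
    using that codimension_le_1_if_nowhere_dense assms(2) by blast
  have ii_i: ?i if ?ii
  proof (rule ccontr)
    assume "\<not> ?i"
    then have k: "k + 2 \<le> CARD('n)" using assms(2) by linarith
    obtain K :: "(real^'n) set" where K: "compact K" "K \<subseteq> unit_cube" "meets_all_flats k K"
        "nowhere_dense (fold_sumset CARD('n) K)"
      using \<open>?ii\<close> by blast
    \<comment> \<open>The origin is an endpoint of the edges in \<open>K\<close>; this reduces (ii)
      to (iii).\<close>
    have "0 \<in> K"
      using axis_segment_in_if_meets_all_flats[OF K(3) k K(2), of 0] by simp
    then have "nowhere_dense (fold_sumset (CARD('n) - 1) K)"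
      using fold_sumset_subset_Suc K(4) Suc by (metis nowhere_dense_subset)
    then show False
      using codimension_le_1_if_nowhere_dense K assms(2) \<open>\<not> ?i\<close> by blast
  qed
  show ?thesis
    using iffI[OF i_ii ii_i] iffI[OF i_iii iii_i] by (rule conjI)
qed

end
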